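(* For every vertical face column $(i-\frac12,j)$ and $(i,j-\frac12)$ and every layer $1\le k\le n_k$, the right-hand sides $f_k^{n+1}$ produced by the forward sweep, $$f_k^{n+1}=\frac{d_k^{n+1}-a_kf_{k-1}^{n+1}}{a_ke_{k-1}^n+b_k},\quad f_0^{n+1}=0,\qquad e_k^n=\frac{-c_k}{a_ke_{k-1}^n+b_k},\quad e_0^n=0$$ (with the coefficients of the respective column), satisfy $$f_{i-\frac12,j,k}^{n+1}=\psi^{(1)}_{i-\frac12,j,k}+\psi^{(2)}_{i-\frac12,j,k}\left(\zeta_{i,j}^{n+1}-\zeta_{i-1,j}^{n+1}\right),$$ $$f_{i,j-\frac12,k}^{n+1}=\psi^{(1)}_{i,j-\frac12,k}+\psi^{(2)}_{i,j-\frac12,k}\left(\zeta_{i,j}^{n+1}-\zeta_{i,j-1}^{n+1}\right),$$ where, for columns in both the $x$ and $y$ directions, $$\psi_k^{(1)}=\frac{d_k'-a_k\psi_{k-1}^{(1)}}{a_ke_{k-1}^n+b_k},\qquad \psi_0^{(1)}=0,$$ and $$\psi^{(2)}_{i-\frac12,j,k}=\frac{-g\frac{\Delta t}{\Delta x}-a_k\psi^{(2)}_{i-\frac12,j,k-1}}{a_ke_{k-1}^n+b_k},\qquad \psi^{(2)}_{i-\frac12,j,0}=0,$$ $$\psi^{(2)}_{i,j-\frac12,k}=\frac{-g\frac{\Delta t}{\Delta y}-a_k\psi^{(2)}_{i,j-\frac12,k-1}}{a_ke_{k-1}^n+b_k},\qquad \psi^{(2)}_{i,j-\frac12,0}=0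.$$
   Context: Setting: one time step, from level $n$ to level $n+1$, of a semi-implicit finite difference scheme on a staggered grid. Horizontal cells are indexed by $(i,j)$. Vertical layers are indexed by $k=1,\dots,n_k$ with $n_k\ge2$ ($k=1$ is the top layer, $k=n_k$ the bottom layer). The time step $\Delta t>0$, cell sizes $\Delta x,\Delta y>0$ and gravity constant $g>0$ are real constants. The real number $\zeta_{i,j}^{n+1}$ is the (unknown) free-surface elevation of cell $(i,j)$ at level $n+1$. Horizontal velocities $u_{i-\frac12,j,k}$ live on the face between cells $(i-1,j)$ and $(i,j)$, and $v_{i,j-\frac12,k}$ on the face between cells $(i,j-1)$ and $(i,j)$. A "face column" is the set of all layers at a fixed horizontal face $(i-\frac12,j)$ or $(i,j-\frac12)$. All quantities below belong to a given face column; horizontal indices are dropped when unnecessary. For each face column, $\Delta z_k>0$ is the thickness of layer $k$, $\Delta z_{k\pm\frac12}>0$ are the vertical spacings at the layer interfaces, and $\nu_{k\pm\frac12}\ge0$ are the vertical eddy viscosities at the interfaces (interface $k-\frac12$ separates layers $k-1$ and $k$). The coefficients are $$a_k=-\frac{\nu_{k-\frac12}\Delta t}{\Delta z_{k-\frac12}\Delta z_k}\ (2\le k\le n_k),\quad c_k=-\frac{\nu_{k+\frac12}\Delta t}{\Delta z_{k+\frac12}\Delta z_k}\ (1\le k\le n_k-1),\quad a_1=c_{n_k}=0,$$ $$b_k=1-(a_k+c_k).$$ The right-hand sides are $$d^{n+1}_{i-\frac12,j,k}=d'_{i-\frac12,j,k}-g\Delta t\,\frac{\zeta^{n+1}_{i,j}-\zeta^{n+1}_{i-1,j}}{\Delta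 x},\qquad d^{n+1}_{i,j-\frac12,k}=d'_{i,j-\frac12,k}-g\Delta t\,\frac{\zeta^{n+1}_{i,j}-\zeta^{n+1}_{i,j-1}}{\Delta y}.$$ Here $d'_k$ are known real numbers depending only on level-$n$ data: $d'_{i-\frac12,j,k}=u^n_{i-\frac12,j,k}+\Delta t\,Fu^n_{i-\frac12,j,k}$, to which $\Delta t\,\tau_{wx}/\Delta z_{i-\frac12,j,1}$ is added for $k=1$ and from which $\Delta t\,\tau_{bx}/\Delta z_{i-\frac12,j,n_k}$ is subtracted for $k=n_k$; and $d'_{i,j-\frac12,k}=v^n_{i,j-\frac12,k}+\Delta t\,Fv^n_{i,j-\frac12,k}$, with $\Delta t\,\tau_{wy}/\Delta z_{i,j-\frac12,1}$ added for $k=1$ and $\Delta t\,\tau_{by}/\Delta z_{i,j-\frac12,n_k}$ subtracted for $k=n_k$. The numbers $Fu^n,Fv^n$ (explicitly treated convection, Coriolis and horizontal viscosity terms), the wind stresses $\tau_{wx},\tau_{wy}$ and the bottom stresses $\tau_{bx},\tau_{by}$ (evaluated at level $n$) are given real numbers. *)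

theory Defs
  imports Complex_Main
begin

text \<open>
  Data of one vertical face column, in either horizontal direction.  Layers are numbered
  from 1 (top).  The interface between layers k and k + 1, written k + 1/2 in the
  literature, carries the index k; hence k - 1/2 becomes k - 1.  In a column of m layers the
  interfaces are 1, ..., m - 1.
\<close>

record face_column =
  dz :: "nat \<Rightarrow> real"       \<comment> \<open>layer thickness\<close>
  dzi :: "nat \<Rightarrow> real"      \<comment> \<open>vertical spacing at an interface\<close>
  visc :: "nat \<Rightarrow> real"     \<comment> \<open>vertical eddy viscosity at an interface\<close>
  vel :: "nat \<Rightarrow> real"      \<comment> \<open>velocity normal to the face (u or v) at the old time level\<close>
  expl :: "nat \<Rightarrow> real"     \<comment> \<open>explicitly treated terms (Fu or Fv) at the old time level\<close>
  tau_w :: real           \<comment> \<open>wind stress\<close>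
  tau_b :: real           \<comment> \<open>bottom stress\<close>

definition admissible :: "nat \<Rightarrow> face_column \<Rightarrow> bool" where
  "admissible nk C \<longleftrightarrow>
     (\<forall>k\<in>{1..nk}. dz C k > 0) \<and> (\<forall>k\<in>{1..<nk}. dzi C k > 0 \<and> visc C k \<ge> 0)"

definition coef_a :: "real \<Rightarrow> face_column \<Rightarrow> nat \<Rightarrow> real" where
  "coef_a dt C k = (if k = 1 then 0 else - (visc C (k - 1) * dt / (dzi C (k - 1) * dz C k)))"

definition coef_c :: "real \<Rightarrow> nat \<Rightarrow> face_column \<Rightarrow> nat \<Rightarrow> real" where
  "coef_c dt nk C k = (if k = nk then 0 else - (visc C k * dt / (dzi C k * dz C k)))"

definition coef_b :: "real \<Rightarrow> nat \<Rightarrow> face_column \<Rightarrow> nat \<Rightarrow> real" where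
  "coef_b dt nk C k = 1 - (coef_a dt C k + coef_c dt nk C k)"

definition d_old :: "real \<Rightarrow> nat \<Rightarrow> face_column \<Rightarrow> nat \<Rightarrow> real" where
  "d_old dt nk C k =
     vel C k + dt * expl C k
     + (if k = 1 then dt * tau_w C / dz C 1 else 0)
     - (if k = nk then dt * tau_b C / dz C nk else 0)"

text \<open>
  Below, \<open>h\<close> is the horizontal cell size across the face and \<open>\<zeta>l\<close>, \<open>\<zeta>r\<close> are the new surface
  elevations of the cells on its lower-index and higher-index side.
\<close>

definition d_new ::
  "real \<Rightarrow> real \<Rightarrow> real \<Rightarrow> nat \<Rightarrow> face_column \<Rightarrow> real \<Rightarrow> real \<Rightarrow> nat \<Rightarrow> real" where
  "d_new g dt h nk C \<zeta>l \<zeta>r k = d_old dt nk C k - g * dt * ((\<zeta>r - \<zeta>l) / h)"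

primrec sweep_e :: "real \<Rightarrow> nat \<Rightarrow> face_column \<Rightarrow> nat \<Rightarrow> real" where
  "sweep_e dt nk C 0 = 0"
| "sweep_e dt nk C (Suc k) =
     - coef_c dt nk C (Suc k) / (coef_a dt C (Suc k) * sweep_e dt nk C k + coef_b dt nk C (Suc k))"

primrec sweep_f ::
  "real \<Rightarrow> real \<Rightarrow> real \<Rightarrow> nat \<Rightarrow> face_column \<Rightarrow> real \<Rightarrow> real \<Rightarrow> nat \<Rightarrow> real" where
  "sweep_f g dt h nk C \<zeta>l \<zeta>r 0 = 0"
| "sweep_f g dt h nk C \<zeta>l \<zeta>r (Suc k) =
     (d_new g dt h nk C \<zeta>l \<zeta>r (Suc k) - coef_a dt C (Suc k) * sweep_f g dt h nk C \<zeta>l \<zeta>r k)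
     / (coef_a dt C (Suc k) * sweep_e dt nk C k + coef_b dt nk C (Suc k))"

primrec psi1 :: "real \<Rightarrow> nat \<Rightarrow> face_column \<Rightarrow> nat \<Rightarrow> real" where
  "psi1 dt nk C 0 = 0"
| "psi1 dt nk C (Suc k) =
     (d_old dt nk C (Suc k) - coef_a dt C (Suc k) * psi1 dt nk C k)
     / (coef_a dt C (Suc k) * sweep_e dt nk C k + coef_b dt nk C (Suc k))"

primrec psi2 :: "real \<Rightarrow> real \<Rightarrow> real \<Rightarrow> nat \<Rightarrow> face_column \<Rightarrow> nat \<Rightarrow> real" where
  "psi2 g dt h nk C 0 = 0"
| "psi2 g dt h nk C (Suc k) =
     (- g * (dt / h) - coef_a dt C (Suc k) * psi2 g dt h nk C k)
     / (coef_a dt C (Suc k) * sweep_e dt nk C k + coef_b dt nk C (Suc k))"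

text \<open>
  Division is total in HOL, so the four recursions express the intended quotients only where
  this denominator is nonzero.
\<close>

definition sweep_defined :: "real \<Rightarrow> nat \<Rightarrow> face_column \<Rightarrow> nat \<Rightarrow> bool" where
  "sweep_defined dt nk C k \<longleftrightarrow>
     coef_a dt C k * sweep_e dt nk C (k - 1) + coef_b dt nk C k \<noteq> 0"

end

theory Submission
  imports Defs
begin

text \<open>
  Two facts about a single face column carry the theorem.

  The forward sweep is well defined because the tridiagonal matrix of a column is strictly
  diagonally dominant.  The off-diagonal coefficients are nonpositive and
  \<open>b = 1 - (a + c)\<close>, so the denominator of layer \<open>k + 1\<close> is \<open>1 - a (1 - e) - c\<close>, with \<open>e\<close> taken
  from layer \<open>k\<close>.  As long as \<open>0 \<le> e \<le> 1\<close> this is at least \<open>1 - c\<close>; it is therefore positive,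
  and the next value \<open>- c / (1 - a (1 - e) - c)\<close> again lies in \<open>[0, 1]\<close>.  The bound on \<open>e\<close> thus
  propagates down the column from \<open>e = 0\<close> above the top layer
  (\<open>sweep_e_bounds\<close>, \<open>sweep_defined_of_admissible\<close>).

  The sweep is linear in its right-hand sides and its coefficients do not involve the new surface
  elevation.  The right-hand sides are affine in the elevation jump across the face, with the same
  slope \<open>- g dt / h\<close> in every layer.  Sweeping the constant part and the slope separately gives
  \<open>psi1\<close> and \<open>psi2\<close>, and their superposition is the full sweep (\<open>sweep_f_affine\<close>).
  Both directions of the grid are instances of these column facts.
\<close>

lemma coef_a_nonpos:
  assumes "admissible nk C" and "dt \<ge> 0" and "k \<in> {1..nk}"
  shows "coef_a dt C k \<le> 0"
proof (cases "k = 1")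
  case True
  then show ?thesis by (simp add: coef_a_def)
next
  case False
  with assms(3) have "k - 1 \<in> {1..<nk}" by auto
  with assms have "visc C (k - 1) \<ge> 0" and "dzi C (k - 1) > 0" and "dz C k > 0"
    by (auto simp: admissible_def)
  with \<open>dt \<ge> 0\<close> False show ?thesis by (simp add: coef_a_def)
qed

lemma coef_c_nonpos:
  assumes "admissible nk C" and "dt \<ge> 0" and "k \<in> {1..nk}"
  shows "coef_c dt nk C k \<le> 0"
proof (cases "k = nk")
  case True
  then show ?thesis by (simp add: coef_c_def)
next
  case False
  with assms(3) have "k \<in> {1..<nk}" by auto
  with assms have "visc C k \<ge> 0" and "dzi C k > 0" and "dz C k > 0"
    by (auto simp: admissible_def)
  with \<open>dt \<ge> 0\<close> False show ?thesis by (simp add: coef_c_def)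
qed

text \<open>
  Diagonal dominance: the denominator exceeds \<open>- coef_c\<close>, the numerator of the next \<open>sweep_e\<close>,
  by \<open>1 - a (1 - e) \<ge> 1\<close>.
\<close>

lemma denominator_ge:
  assumes "admissible nk C" and "dt \<ge> 0" and "k \<in> {1..nk}" and "e \<le> 1"
  shows "coef_a dt C k * e + coef_b dt nk C k \<ge> 1 - coef_c dt nk C k"
proof -
  have "coef_a dt C k * (1 - e) \<le> 0"
    using coef_a_nonpos[OF assms(1-3)] \<open>e \<le> 1\<close> by (intro mult_nonpos_nonneg) auto
  then show ?thesis by (simp add: coef_b_def algebra_simps)
qed

lemma sweep_e_bounds:
  assumes "admissible nk C" and "dt \<ge> 0" and "k \<le> nk"
  shows "0 \<le> sweep_e dt nk C k \<and> sweep_e dt nk C k \<le> 1"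
  using \<open>k \<le> nk\<close>
proof (induction k)
  case 0
  show ?case by simp
next
  case (Suc k)
  then have layer: "Suc k \<in> {1..nk}" and "sweep_e dt nk C k \<le> 1" by auto
  with denominator_ge[OF assms(1,2)]
  have "coef_a dt C (Suc k) * sweep_e dt nk C k + coef_b dt nk C (Suc k)
          \<ge> 1 - coef_c dt nk C (Suc k)" by blast
  with coef_c_nonpos[OF assms(1,2) layer] show ?case
    by (simp add: divide_simps)
qed

lemma sweep_defined_of_admissible:
  assumes "admissible nk C" and "dt \<ge> 0" and "k \<in> {1..nk}"
  shows "sweep_defined dt nk C k"
proof -
  have "sweep_e dt nk C (k - 1) \<le> 1"
    using sweep_e_bounds[OF assms(1,2), of "k - 1"] assms(3) by auto
  with denominator_ge[OF assms] coef_c_nonpos[OF assms] show ?thesis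
    unfolding sweep_defined_def by fastforce
qed

lemma d_new_affine:
  "d_new g dt h nk C \<zeta>l \<zeta>r k = d_old dt nk C k + (- g * (dt / h)) * (\<zeta>r - \<zeta>l)"
  by (simp add: d_new_def)

text \<open>
  Superposition: the three recursions share the same homogeneous part and denominators, so the
  decomposition of \<open>d_new_affine\<close> passes from the right-hand sides to the swept values.
\<close>

lemma sweep_f_affine:
  "sweep_f g dt h nk C \<zeta>l \<zeta>r k = psi1 dt nk C k + psi2 g dt h nk C k * (\<zeta>r - \<zeta>l)"
proof (induction k)
  case 0
  show ?case by simp
next
  case (Suc k)
  define D where "D = coef_a dt C (Suc k) * sweep_e dt nk C k + coef_b dt nk C (Suc k)"
  have superpose: "(d + s * x - a * (p + q * x)) / D = (d - a * p) / D + (s - a * q) / D * x"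
    for d s x a p q :: real
    by (simp add: add_divide_distrib diff_divide_distrib algebra_simps)
  show ?case
    by (simp only: sweep_f.simps psi1.simps psi2.simps Suc.IH d_new_affine superpose
        flip: D_def)
qed

theorem lemma1:
  fixes nk :: nat and dt dx dy g :: real
    and \<zeta> :: "int \<Rightarrow> int \<Rightarrow> real"
    and X Y :: "int \<Rightarrow> int \<Rightarrow> face_column"
    and FX FY :: "(int \<times> int) set"
  assumes "nk \<ge> 2" and "dt > 0" and "dx > 0" and "dy > 0" and "g > 0"
    and "\<And>i j. (i, j) \<in> FX \<Longrightarrow> admissible nk (X i j)"
    and "\<And>i j. (i, j) \<in> FY \<Longrightarrow> admissible nk (Y i j)"
  shows "(\<forall>(i, j)\<in>FX. \<forall>k\<in>{1..nk}.
            sweep_defined dt nk (X i j) k \<and>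
            sweep_f g dt dx nk (X i j) (\<zeta> (i - 1) j) (\<zeta> i j) k =
              psi1 dt nk (X i j) k + psi2 g dt dx nk (X i j) k * (\<zeta> i j - \<zeta> (i - 1) j)) \<and>
         (\<forall>(i, j)\<in>FY. \<forall>k\<in>{1..nk}.
            sweep_defined dt nk (Y i j) k \<and>
            sweep_f g dt dy nk (Y i j) (\<zeta> i (j - 1)) (\<zeta> i j) k =
              psi1 dt nk (Y i j) k + psi2 g dt dy nk (Y i j) k * (\<zeta> i j - \<zeta> i (j - 1)))"
  using assms
  by (auto simp del: atLeastAtMost_iff
      intro!: sweep_defined_of_admissible sweep_f_affine)

end
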